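(* Let $\mathcal{G}=(S,R,O)$ be a perfect information game, let $\mathcal{M}$ be an epistemic model w.r.t. $\mathcal{G}$, let $\mathcal{U}$ be an observation model, let $\mathcal{F}^{\otimes}(\mathcal{M})=(W,\sim,\to,V)$ be the run model generated from $\mathcal{M}$ by repeatedly updating with $\mathcal{U}$, and let $f:W\to S$ be the induced state assignment function w.r.t. $\mathcal{F}^{\otimes}(\mathcal{M})$. Then $f$ is a p-morphism from $\mathcal{F}^{\otimes}(\mathcal{M})$ to the induced epistemic game structure $E(\mathcal{G})=(S,\sim',R,O)$.
   Context: Fixed data: $I$ is a non-empty finite set of players; $A=\biguplus_{i\in I}A_i$ is a non-empty finite set of actions, the sets $A_i$ being mutually disjoint; $P$ is a finite set of information pieces containing a designated piece $p^a$ for each $a\in A$. Game structure: $\mathcal{G}=(S,R,O)$ where $S$ is a non-empty set of states; $R$ is a partial function $S\times A\to S$ such that if $R(s,a)$ is defined then $\iota(s)=i$ for some $i\in I$, where $\iota(s)=i$ iff $\emptyset\subset\{a\mid R(s,a)\text{ is defined}\}\subseteq A_i$; and $O:S\times I\to 2^P$ is a function such that for all $s\in S$, $i\in I$, $a\in A_i$: $p^a\in O(s,i)$ iff $R(s,a)$ is defined. Write $sR_at$ for $R(s,a)=t$, and $e(s)=\{a\mid R(s,a)\text{ is defined}\}$. Epistemic model w.r.t. $\mathcal{G}$: $\mathcal{M}=(W,f,\sim,V)$ where $W$ is a non-empty set, $f:W\to S$, each $\sim_i$ ($i\in I$) is an equivalence relation on $W$ such that $w\sim_i v$ implies $O(f(w),i)=O(f(v),i)$,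 and $V:W\times I\to 2^P$ satisfies $V(w,i)=O(f(w),i)$. Observation model: $\mathcal{U}=(A,\leftrightsquigarrow)$ where each $\leftrightsquigarrow_i$ ($i\in I$) is an equivalence relation on $A$. Update product: $\mathcal{M}\otimes\mathcal{U}=(W',f',\sim',V')$ with $W'=\{(w,a)\mid w\in W, a\in e(f(w))\}$; $f'((w,a))=R(f(w),a)$; $(w,a)\sim'_i(u,b)$ iff $w\sim_i u$, $a\leftrightsquigarrow_i b$ and $O(R(f(w),a),i)=O(R(f(u),b),i)$; $V'((w,a),i)=O(R(f(w),a),i)$. $\mathcal{M}\otimes\mathcal{U}^k$ is the $k$-fold iterate (possibly with empty domain), with $\mathcal{M}\otimes\mathcal{U}^0=\mathcal{M}$. Epistemic temporal model: $\mathcal{N}=(W,\{\sim_i\}_{i\in I},\{\xrightarrow{a}\}_{a\in A},V)$ where $W$ is a non-empty set, each $\sim_i$ is an equivalence relation on $W$, each $\xrightarrow{a}\subseteq W\times W$, and $V:W\times I\to 2^P$. Run model: $\mathcal{F}^\otimes(\mathcal{M})$ is the epistemic temporal model $(W,\sim,\to,V)$ whose states are the sequences $(s,a_1,\dots,a_k)$, $k\ge 0$, that exist in $\mathcal{M}\otimes\mathcal{U}^k$ (iterated pairs identified with sequences) and for which $f_{\mathcal{M}}(s)R_{a_1}t_1R_{a_2}\cdots R_{a_k}t_k$ for some game states $t_1,\dots,t_k$; $(s,a_1,\dots,a_k)\sim_i(t,a'_1,\dots,a'_j)$ iff $k=j$ and the two are $\sim_i$-related in $\mathcal{M}\otimes\mathcal{U}^k$;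 $(s,a_1,\dots,a_k)\xrightarrow{a}(t,a'_1,\dots,a'_j)$ iff $s=t$ and $a'_1\dots a'_j=a_1\dots a_k a$; $V((s,a_1,\dots,a_k),i)=V_{\mathcal{M}\otimes\mathcal{U}^k}((s,a_1,\dots,a_k),i)$. The induced state assignment function is $f((s,a_1,\dots,a_k))=f_{\mathcal{M}\otimes\mathcal{U}^k}((s,a_1,\dots,a_k))\in S$. Induced epistemic game structure: $E(\mathcal{G})=(S,\sim',R,O)$ where $\sim'_i=\{(s,t)\mid O(s,i)=O(t,i)\}$, viewed as an epistemic temporal model with transitions $R_a$ and valuation $O$. $\mathcal{G}$ is a perfect information game if every $\sim'_i$ in $E(\mathcal{G})$ is the identity relation on $S$. p-morphism: for epistemic temporal models $(W,\sim,\{R_a\}_{a\in A},V)$ and $(W',\sim',\{R'_a\}_{a\in A},V')$, a function $f:W\to W'$ is a p-morphism if for all $w,u\in W$, $s\in W'$, $a\in A$, $i\in I$: (1) $V(w,i)=V'(f(w),i)$; (2) $w\sim_i u$ implies $f(w)\sim'_i f(u)$; (3) if $f(w)\sim'_i s$ then there is $v\in W$ with $f(v)=s$ and $w\sim_i v$; (4) $wR_au$ implies $f(w)R'_af(u)$; (5) if $f(w)R'_as$ then there is $v\in W$ with $f(v)=s$ and $wR_av$. *)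

theory Defs
  imports "HOL-Library.FuncSet" "HOL-Library.Disjoint_Sets"
begin

definition all_actions :: "'i set \<Rightarrow> ('i \<Rightarrow> 'a set) \<Rightarrow> 'a set" where
  "all_actions I Act = (\<Union>i\<in>I. Act i)"

text \<open>
  The fixed data: players \<open>I\<close>, the action set \<open>Act i\<close> of each player, information pieces \<open>P\<close>,
  and the designated piece \<open>pa a\<close> for each action \<open>a\<close>. The map \<open>pa\<close> is not required to be
  injective.
\<close>

definition fixed_data :: "'i set \<Rightarrow> ('i \<Rightarrow> 'a set) \<Rightarrow> 'p set \<Rightarrow> ('a \<Rightarrow> 'p) \<Rightarrow> bool" where
  "fixed_data I Act P pa \<longleftrightarrow>
     finite I \<and> I \<noteq> {} \<and>
     finite (all_actions I Act) \<and> all_actions I Act \<noteq> {} \<and>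
     disjoint_family_on Act I \<and>
     finite P \<and> pa \<in> all_actions I Act \<rightarrow> P"


record ('s, 'i, 'a, 'p) game =
  gstates :: "'s set"
  move :: "'s \<times> 'a \<rightharpoonup> 's"
  obs :: "'s \<Rightarrow> 'i \<Rightarrow> 'p set"

definition enabled :: "('s, 'i, 'a, 'p) game \<Rightarrow> 's \<Rightarrow> 'a set" where
  "enabled G s = {a. (s, a) \<in> dom (move G)}"

definition turn :: "('i \<Rightarrow> 'a set) \<Rightarrow> ('s, 'i, 'a, 'p) game \<Rightarrow> 's \<Rightarrow> 'i \<Rightarrow> bool" where
  "turn Act G s i \<longleftrightarrow> {} \<subset> enabled G s \<and> enabled G s \<subseteq> Act i"

definition game_structure ::
  "'i set \<Rightarrow> ('i \<Rightarrow> 'a set) \<Rightarrow> 'p set \<Rightarrow> ('a \<Rightarrow> 'p) \<Rightarrow> ('s, 'i, 'a, 'p) game \<Rightarrow> bool" where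
  "game_structure I Act P pa G \<longleftrightarrow>
     gstates G \<noteq> {} \<and>
     dom (move G) \<subseteq> gstates G \<times> all_actions I Act \<and> ran (move G) \<subseteq> gstates G \<and>
     (\<forall>s a. (s, a) \<in> dom (move G) \<longrightarrow> (\<exists>i\<in>I. turn Act G s i)) \<and>
     (\<forall>s\<in>gstates G. \<forall>i\<in>I. obs G s i \<subseteq> P) \<and>
     (\<forall>s\<in>gstates G. \<forall>i\<in>I. \<forall>a\<in>Act i. pa a \<in> obs G s i \<longleftrightarrow> (s, a) \<in> dom (move G))"


record ('w, 's, 'i, 'p) epmodel =
  worlds :: "'w set"
  assign :: "'w \<Rightarrow> 's"
  indist :: "'i \<Rightarrow> 'w rel"
  valu :: "'w \<Rightarrow> 'i \<Rightarrow> 'p set"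

definition epistemic_model ::
  "'i set \<Rightarrow> ('s, 'i, 'a, 'p) game \<Rightarrow> ('w, 's, 'i, 'p) epmodel \<Rightarrow> bool" where
  "epistemic_model I G M \<longleftrightarrow>
     worlds M \<noteq> {} \<and>
     assign M \<in> worlds M \<rightarrow> gstates G \<and>
     (\<forall>i\<in>I. equiv (worlds M) (indist M i)) \<and>
     (\<forall>i\<in>I. \<forall>w v. (w, v) \<in> indist M i \<longrightarrow> obs G (assign M w) i = obs G (assign M v) i) \<and>
     (\<forall>w\<in>worlds M. \<forall>i\<in>I. valu M w i = obs G (assign M w) i)"

definition observation_model ::
  "'i set \<Rightarrow> ('i \<Rightarrow> 'a set) \<Rightarrow> ('i \<Rightarrow> 'a rel) \<Rightarrow> bool" where
  "observation_model I Act U \<longleftrightarrow> (\<forall>i\<in>I. equiv (all_actions I Act) (U i))"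

definition update_product ::
  "('s, 'i, 'a, 'p) game \<Rightarrow> ('w, 's, 'i, 'p) epmodel \<Rightarrow> ('i \<Rightarrow> 'a rel) \<Rightarrow>
     ('w \<times> 'a, 's, 'i, 'p) epmodel" where
  "update_product G M U =
     (let W' = {(w, a). w \<in> worlds M \<and> a \<in> enabled G (assign M w)};
          f' = (\<lambda>(w, a). the (move G (assign M w, a)))
      in \<lparr> worlds = W',
           assign = f',
           indist = (\<lambda>i. {((w, a), (u, b)). (w, a) \<in> W' \<and> (u, b) \<in> W' \<and>
                            (w, u) \<in> indist M i \<and> (a, b) \<in> U i \<and>
                            obs G (f' (w, a)) i = obs G (f' (u, b)) i}),
           valu = (\<lambda>x i. obs G (f' x) i) \<rparr>)"

text \<open>
  The worlds of the \<open>k\<close>-fold product are nested pairs, whose type would depend on \<open>k\<close>. They are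
  identified with pairs of an initial world and a list of \<open>k\<close> actions (in chronological order) by
  transporting the model along an injective renaming of its worlds after every product.
\<close>

definition rename_worlds ::
  "('v \<Rightarrow> 'w) \<Rightarrow> ('v, 's, 'i, 'p) epmodel \<Rightarrow> ('w, 's, 'i, 'p) epmodel" where
  "rename_worlds g M =
     \<lparr> worlds = g ` worlds M,
       assign = (\<lambda>x. assign M (inv_into (worlds M) g x)),
       indist = (\<lambda>i. map_prod g g ` indist M i),
       valu = (\<lambda>x. valu M (inv_into (worlds M) g x)) \<rparr>"

fun append_action :: "('w \<times> 'a list) \<times> 'a \<Rightarrow> 'w \<times> 'a list" where
  "append_action ((w, as), a) = (w, as @ [a])"

lemma inj_append_action: "inj append_action"
  by (rule injI) (auto elim!: append_action.elims)

primrec iterated_update ::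
  "('s, 'i, 'a, 'p) game \<Rightarrow> ('w, 's, 'i, 'p) epmodel \<Rightarrow> ('i \<Rightarrow> 'a rel) \<Rightarrow> nat \<Rightarrow>
     ('w \<times> 'a list, 's, 'i, 'p) epmodel" where
  "iterated_update G M U 0 = rename_worlds (\<lambda>w. (w, [])) M"
| "iterated_update G M U (Suc k) =
     rename_worlds append_action (update_product G (iterated_update G M U k) U)"


record ('w, 'i, 'a, 'p) etmodel =
  points :: "'w set"
  sim :: "'i \<Rightarrow> 'w rel"
  trns :: "'a \<Rightarrow> 'w rel"
  val :: "'w \<Rightarrow> 'i \<Rightarrow> 'p set"

definition epistemic_temporal_model ::
  "'i set \<Rightarrow> ('i \<Rightarrow> 'a set) \<Rightarrow> 'p set \<Rightarrow> ('w, 'i, 'a, 'p) etmodel \<Rightarrow> bool" where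
  "epistemic_temporal_model I Act P N \<longleftrightarrow>
     points N \<noteq> {} \<and>
     (\<forall>i\<in>I. equiv (points N) (sim N i)) \<and>
     (\<forall>a\<in>all_actions I Act. trns N a \<subseteq> points N \<times> points N) \<and>
     (\<forall>w\<in>points N. \<forall>i\<in>I. val N w i \<subseteq> P)"

fun playable :: "('s, 'i, 'a, 'p) game \<Rightarrow> 's \<Rightarrow> 'a list \<Rightarrow> bool" where
  "playable G s [] \<longleftrightarrow> True"
| "playable G s (a # as) \<longleftrightarrow> (\<exists>t\<in>gstates G. move G (s, a) = Some t \<and> playable G t as)"

definition runs ::
  "('s, 'i, 'a, 'p) game \<Rightarrow> ('w, 's, 'i, 'p) epmodel \<Rightarrow> ('i \<Rightarrow> 'a rel) \<Rightarrow> ('w \<times> 'a list) set" where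
  "runs G M U = {(s, as). (s, as) \<in> worlds (iterated_update G M U (length as)) \<and>
                          playable G (assign M s) as}"

definition run_model ::
  "('s, 'i, 'a, 'p) game \<Rightarrow> ('w, 's, 'i, 'p) epmodel \<Rightarrow> ('i \<Rightarrow> 'a rel) \<Rightarrow>
     ('w \<times> 'a list, 'i, 'a, 'p) etmodel" where
  "run_model G M U =
     \<lparr> points = runs G M U,
       sim = (\<lambda>i. {((s, as), (t, bs)). (s, as) \<in> runs G M U \<and> (t, bs) \<in> runs G M U \<and>
                     length as = length bs \<and>
                     ((s, as), (t, bs)) \<in> indist (iterated_update G M U (length as)) i}),
       trns = (\<lambda>a. {((s, as), (t, bs)). (s, as) \<in> runs G M U \<and> (t, bs) \<in> runs G M U \<and>
                     s = t \<and> bs = as @ [a]}),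
       val = (\<lambda>(s, as). valu (iterated_update G M U (length as)) (s, as)) \<rparr>"

definition run_state ::
  "('s, 'i, 'a, 'p) game \<Rightarrow> ('w, 's, 'i, 'p) epmodel \<Rightarrow> ('i \<Rightarrow> 'a rel) \<Rightarrow> 'w \<times> 'a list \<Rightarrow> 's" where
  "run_state G M U = (\<lambda>(s, as). assign (iterated_update G M U (length as)) (s, as))"


definition induced_epistemic_game ::
  "('s, 'i, 'a, 'p) game \<Rightarrow> ('s, 'i, 'a, 'p) etmodel" where
  "induced_epistemic_game G =
     \<lparr> points = gstates G,
       sim = (\<lambda>i. {(s, t). s \<in> gstates G \<and> t \<in> gstates G \<and> obs G s i = obs G t i}),
       trns = (\<lambda>a. {(s, t). move G (s, a) = Some t}),
       val = obs G \<rparr>"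

definition perfect_information :: "'i set \<Rightarrow> ('s, 'i, 'a, 'p) game \<Rightarrow> bool" where
  "perfect_information I G \<longleftrightarrow> (\<forall>i\<in>I. sim (induced_epistemic_game G) i = Id_on (gstates G))"

text \<open>
  Being a p-morphism includes that both structures are epistemic temporal models and that the
  function maps the domain of the first into the domain of the second.
\<close>

definition p_morphism ::
  "'i set \<Rightarrow> ('i \<Rightarrow> 'a set) \<Rightarrow> 'p set \<Rightarrow> ('w, 'i, 'a, 'p) etmodel \<Rightarrow> ('v, 'i, 'a, 'p) etmodel \<Rightarrow>
     ('w \<Rightarrow> 'v) \<Rightarrow> bool" where
  "p_morphism I Act P N N' f \<longleftrightarrow>
     epistemic_temporal_model I Act P N \<and> epistemic_temporal_model I Act P N' \<and>
     f \<in> points N \<rightarrow> points N' \<and>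
     (\<forall>w\<in>points N. \<forall>u\<in>points N. \<forall>s\<in>points N'. \<forall>a\<in>all_actions I Act. \<forall>i\<in>I.
        val N w i = val N' (f w) i \<and>
        ((w, u) \<in> sim N i \<longrightarrow> (f w, f u) \<in> sim N' i) \<and>
        ((f w, s) \<in> sim N' i \<longrightarrow> (\<exists>v\<in>points N. f v = s \<and> (w, v) \<in> sim N i)) \<and>
        ((w, u) \<in> trns N a \<longrightarrow> (f w, f u) \<in> trns N' a) \<and>
        ((f w, s) \<in> trns N' a \<longrightarrow> (\<exists>v\<in>points N. f v = s \<and> (w, v) \<in> trns N a)))"

end

theory Submission
  imports Defs
begin

text \<open>
  Every iterated product is again an epistemic model, except that it may be empty, so related runs
  end in states with equal observations. By perfect information, states with equal observations
  coincide, so the backward condition for indistinguishability reduces to reflexivity. The one for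
  the transitions holds because the product has a world for every enabled action.
\<close>

section \<open>Epistemic models with possibly empty domain, and renaming of worlds\<close>

text \<open>Non-emptiness is left out because a product is empty as soon as no world is assigned a
  state with an enabled action; the remaining clauses form the invariant of the iteration.\<close>

definition epistemic_premodel ::
  "'i set \<Rightarrow> ('s, 'i, 'a, 'p) game \<Rightarrow> ('w, 's, 'i, 'p) epmodel \<Rightarrow> bool" where
  "epistemic_premodel I G M \<longleftrightarrow>
     assign M \<in> worlds M \<rightarrow> gstates G \<and>
     (\<forall>i\<in>I. equiv (worlds M) (indist M i)) \<and>
     (\<forall>i\<in>I. \<forall>w v. (w, v) \<in> indist M i \<longrightarrow> obs G (assign M w) i = obs G (assign M v) i) \<and>
     (\<forall>w\<in>worlds M. \<forall>i\<in>I. valu M w i = obs G (assign M w) i)"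

lemma epistemic_model_iff_premodel:
  "epistemic_model I G M \<longleftrightarrow> worlds M \<noteq> {} \<and> epistemic_premodel I G M"
  by (simp add: epistemic_model_def epistemic_premodel_def)

lemma worlds_rename_worlds [simp]: "worlds (rename_worlds g M) = g ` worlds M"
  by (simp add: rename_worlds_def)

lemma indist_rename_worlds [simp]: "indist (rename_worlds g M) i = map_prod g g ` indist M i"
  by (simp add: rename_worlds_def)

lemma assign_rename_worlds:
  "inj_on g (worlds M) \<Longrightarrow> w \<in> worlds M \<Longrightarrow> assign (rename_worlds g M) (g w) = assign M w"
  by (simp add: rename_worlds_def)

lemma valu_rename_worlds:
  "inj_on g (worlds M) \<Longrightarrow> w \<in> worlds M \<Longrightarrow> valu (rename_worlds g M) (g w) = valu M w"
  by (simp add: rename_worlds_def)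

lemma equiv_map_prod_image:
  assumes "equiv A r" and "inj_on g A"
  shows "equiv (g ` A) (map_prod g g ` r)"
proof -
  have sub: "r \<subseteq> A \<times> A" using assms(1) by (auto simp: equiv_def refl_on_def)
  show ?thesis
  proof (rule equivI)
    show "map_prod g g ` r \<subseteq> g ` A \<times> g ` A" using sub by auto
    show "refl_on (g ` A) (map_prod g g ` r)"
      using assms(1) by (auto simp: equiv_def refl_on_def image_iff) (metis map_prod_simp)
    show "sym (map_prod g g ` r)"
      using assms(1) by (auto simp: equiv_def sym_def image_iff) (metis map_prod_simp)
    show "trans (map_prod g g ` r)"
    proof (rule transI)
      fix x y z assume "(x, y) \<in> map_prod g g ` r" "(y, z) \<in> map_prod g g ` r"
      then obtain a b b' c where *: "(a, b) \<in> r" "(b', c) \<in> r" "x = g a" "y = g b" "y = g b'" "z = g c"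
        by auto
      \<comment> \<open>The two pairs may reach the middle point through different preimages;
        injectivity on \<open>A\<close> identifies them.\<close>
      then have "b = b'" using sub assms(2) by (metis inj_onD mem_Sigma_iff subsetD)
      then have "(a, c) \<in> r" using * assms(1) by (meson equivE transE)
      then show "(x, z) \<in> map_prod g g ` r" using * by (auto intro: rev_image_eqI)
    qed
  qed
qed

lemma epistemic_premodel_rename_worlds:
  assumes "epistemic_premodel I G M" and "inj_on g (worlds M)"
  shows "epistemic_premodel I G (rename_worlds g M)"
proof -
  \<comment> \<open>Renamed assignments go through \<open>inv_into\<close>, so they can be evaluated
    only once both related worlds are known to lie in the domain.\<close>
  have sub: "w \<in> worlds M" "v \<in> worlds M" if "(w, v) \<in> indist M i" "i \<in> I" for w v i
    using assms(1) that by (auto simp: epistemic_premodel_def equiv_def refl_on_def)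
  have "obs G (assign (rename_worlds g M) (g w)) i = obs G (assign (rename_worlds g M) (g v)) i"
    if "(w, v) \<in> indist M i" "i \<in> I" for w v i
    using sub[OF that] that assms by (auto simp: assign_rename_worlds epistemic_premodel_def)
  then show ?thesis
    using assms unfolding epistemic_premodel_def
    by (auto simp: assign_rename_worlds valu_rename_worlds Pi_iff
        intro!: equiv_map_prod_image)
qed

section \<open>Update products\<close>

lemma worlds_update_product [simp]:
  "(w, a) \<in> worlds (update_product G M U) \<longleftrightarrow> w \<in> worlds M \<and> a \<in> enabled G (assign M w)"
  by (simp add: update_product_def Let_def)

lemma assign_update_product [simp]:
  "assign (update_product G M U) (w, a) = the (move G (assign M w, a))"
  by (simp add: update_product_def Let_def)

lemma epistemic_premodel_update_product:
  assumes "game_structure I Act P pa G" and "observation_model I Act U"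
    and "epistemic_premodel I G M"
  shows "epistemic_premodel I G (update_product G M U)"
proof -
  let ?N = "update_product G M U"
  \<comment> \<open>\<open>U i\<close> is reflexive only on \<open>all_actions I Act\<close>, so
    reflexivity of the product relation requires enabled actions to lie there.\<close>
  have act: "a \<in> all_actions I Act" if "a \<in> enabled G s" for a s
    using that assms(1) by (auto simp: game_structure_def enabled_def)
  have eqM: "equiv (worlds M) (indist M i)" and eqU: "equiv (all_actions I Act) (U i)"
    if "i \<in> I" for i
    using that assms(2,3) by (auto simp: observation_model_def epistemic_premodel_def)
  have "equiv (worlds ?N) (indist ?N i)" if i: "i \<in> I" for i
  proof (rule equivI)
    show "indist ?N i \<subseteq> worlds ?N \<times> worlds ?N"
      by (auto simp: update_product_def Let_def)
    show "refl_on (worlds ?N) (indist ?N i)"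
      using eqM[OF i] eqU[OF i] act
      by (auto simp: update_product_def Let_def refl_on_def equiv_def)
    show "sym (indist ?N i)"
      using eqM[OF i] eqU[OF i]
      by (auto simp: update_product_def Let_def equiv_def intro!: symI dest: symD)
    show "trans (indist ?N i)"
      using eqM[OF i] eqU[OF i]
      by (auto simp: update_product_def Let_def equiv_def intro!: transI dest: transD)
  qed
  moreover have "assign ?N \<in> worlds ?N \<rightarrow> gstates G"
  proof
    fix x assume "x \<in> worlds ?N"
    then obtain w a where x: "x = (w, a)" "a \<in> enabled G (assign M w)"
      by (cases x) auto
    then obtain t where "move G (assign M w, a) = Some t"
      by (auto simp: enabled_def)
    then show "assign ?N x \<in> gstates G"
      using assms(1) x by (auto simp: game_structure_def ran_def)
  qed
  \<comment> \<open>The clauses on observations and valuation are built into the product relation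
    and the product valuation.\<close>
  ultimately show ?thesis
    by (auto simp: epistemic_premodel_def) (auto simp: update_product_def Let_def)
qed

section \<open>Iterated products\<close>

lemma epistemic_premodel_iterated_update:
  assumes "game_structure I Act P pa G" and "observation_model I Act U"
    and "epistemic_model I G M"
  shows "epistemic_premodel I G (iterated_update G M U k)"
proof (induction k)
  case 0
  then show ?case
    using assms(3)
    by (auto simp: epistemic_model_iff_premodel intro!: epistemic_premodel_rename_worlds inj_onI)
next
  case (Suc k)
  then show ?case
    using epistemic_premodel_update_product[OF assms(1,2)] inj_append_action
    by (auto intro!: epistemic_premodel_rename_worlds intro: inj_on_subset)
qed

lemma worlds_iterated_update_Suc [simp]:
  "(w, as @ [a]) \<in> worlds (iterated_update G M U (Suc k)) \<longleftrightarrow>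
     (w, as) \<in> worlds (iterated_update G M U k) \<and>
     a \<in> enabled G (assign (iterated_update G M U k) (w, as))"
proof -
  \<comment> \<open>Seen as a value of the injective renaming, the sequence lies in the image
    exactly when its unique preimage is a world of the product.\<close>
  have "(w, as @ [a]) = append_action ((w, as), a)" by simp
  then show ?thesis
    by (simp del: append_action.simps add: inj_image_mem_iff[OF inj_append_action])
qed

text \<open>Each product moves the assigned state along the last action, so the state is found by
  playing the whole sequence from the initial state. Every \<open>the\<close> meets a defined move,
  since the actions of a world are enabled when appended.\<close>

lemma assign_iterated_update:
  "(w, as) \<in> worlds (iterated_update G M U (length as)) \<Longrightarrow>
     assign (iterated_update G M U (length as)) (w, as)
       = foldl (\<lambda>s a. the (move G (s, a))) (assign M w) as"
proof (induction as rule: rev_induct)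
  case Nil
  then show ?case
    using assign_rename_worlds[of "\<lambda>w. (w, [])" M w] by (auto simp: inj_on_def)
next
  case (snoc a as)
  have "assign (iterated_update G M U (Suc (length as))) (append_action ((w, as), a))
      = assign (update_product G (iterated_update G M U (length as)) U) ((w, as), a)"
    unfolding iterated_update.simps
    using snoc.prems inj_append_action
    by (intro assign_rename_worlds) (auto simp del: iterated_update.simps intro: inj_on_subset)
  then show ?case
    using snoc by (simp del: iterated_update.simps)
qed

section \<open>Playable sequences and runs\<close>

text \<open>Bridges two directions of recursion: \<open>playable\<close> consumes actions from the
  front, whereas products append them at the end.\<close>

lemma playable_snoc:
  "playable G s (as @ [a]) \<longleftrightarrow> playable G s as \<and>
     (\<exists>t\<in>gstates G. move G (foldl (\<lambda>s a. the (move G (s, a))) s as, a) = Some t)"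
  by (induction as arbitrary: s) auto

lemma playable_if_in_iterated_update:
  assumes "game_structure I Act P pa G"
  shows "(w, as) \<in> worlds (iterated_update G M U (length as)) \<Longrightarrow> playable G (assign M w) as"
proof (induction as rule: rev_induct)
  case (snoc a as)
  then have w: "(w, as) \<in> worlds (iterated_update G M U (length as))"
    and "a \<in> enabled G (assign (iterated_update G M U (length as)) (w, as))"
    by (simp_all del: iterated_update.simps)
  then obtain t where t: "move G (foldl (\<lambda>s a. the (move G (s, a))) (assign M w) as, a) = Some t"
    by (auto simp: enabled_def assign_iterated_update)
  then have "t \<in> gstates G"
    using assms by (auto simp: game_structure_def ran_def)
  then show ?case
    using snoc.IH[OF w] t by (auto simp: playable_snoc)
qed simp

lemma in_runs_iff:
  "game_structure I Act P pa G \<Longrightarrow>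
     (w, as) \<in> runs G M U \<longleftrightarrow> (w, as) \<in> worlds (iterated_update G M U (length as))"
  using playable_if_in_iterated_update by (fastforce simp: runs_def)

lemma runs_snoc_iff:
  assumes "game_structure I Act P pa G"
  shows "(w, as @ [a]) \<in> runs G M U \<longleftrightarrow>
    (w, as) \<in> runs G M U \<and> a \<in> enabled G (run_state G M U (w, as))"
  by (simp add: in_runs_iff[OF assms] run_state_def del: iterated_update.simps)

lemma run_state_snoc:
  assumes "game_structure I Act P pa G" and "(w, as @ [a]) \<in> runs G M U"
  shows "move G (run_state G M U (w, as), a) = Some (run_state G M U (w, as @ [a]))"
proof -
  have "run_state G M U (w, as @ [a]) = the (move G (run_state G M U (w, as), a))"
    using assms runs_snoc_iff[OF assms(1)]
      assign_iterated_update[of w as G M U] assign_iterated_update[of w "as @ [a]" G M U]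
    by (simp add: in_runs_iff[OF assms(1)] run_state_def del: iterated_update.simps)
  \<comment> \<open>As \<open>a\<close> is enabled at the current state, \<open>the\<close> is
    applied to a defined move and can be replaced by \<open>Some\<close> on the other side.\<close>
  then show ?thesis
    using assms(2) by (auto simp: runs_snoc_iff[OF assms(1)] enabled_def)
qed

lemma run_state_in_gstates:
  assumes "game_structure I Act P pa G" and "observation_model I Act U"
    and "epistemic_model I G M" and "x \<in> runs G M U"
  shows "run_state G M U x \<in> gstates G"
  using epistemic_premodel_iterated_update[OF assms(1-3)] assms(4)
  by (cases x) (auto simp: in_runs_iff[OF assms(1)] run_state_def epistemic_premodel_def Pi_iff)

section \<open>The run model and the induced game as epistemic temporal models\<close>

lemma val_run_model:
  assumes "game_structure I Act P pa G" and "observation_model I Act U"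
    and "epistemic_model I G M" and "x \<in> runs G M U" and "i \<in> I"
  shows "val (run_model G M U) x i = obs G (run_state G M U x) i"
  using epistemic_premodel_iterated_update[OF assms(1-3)] assms(4,5)
  by (cases x)
    (auto simp: in_runs_iff[OF assms(1)] run_state_def run_model_def epistemic_premodel_def)

text \<open>Related runs have equal length, hence are related worlds of one and the same product,
  where the observation clause of \<open>epistemic_premodel\<close> applies.\<close>

lemma obs_eq_if_sim_run_model:
  assumes "game_structure I Act P pa G" and "observation_model I Act U"
    and "epistemic_model I G M" and "(x, y) \<in> sim (run_model G M U) i" and "i \<in> I"
  shows "obs G (run_state G M U x) i = obs G (run_state G M U y) i"
  using epistemic_premodel_iterated_update[OF assms(1-3)] assms(4,5)
  by (fastforce simp: run_state_def run_model_def epistemic_premodel_def)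

text \<open>The relation is the disjoint union, over all lengths \<open>k\<close>, of the relations
  of the \<open>k\<close>-fold products on runs of length \<open>k\<close>.\<close>

lemma equiv_sim_run_model:
  assumes "game_structure I Act P pa G" and "observation_model I Act U"
    and "epistemic_model I G M" and "i \<in> I"
  shows "equiv (runs G M U) (sim (run_model G M U) i)"
proof -
  have eq: "equiv (worlds (iterated_update G M U k)) (indist (iterated_update G M U k) i)" for k
    using epistemic_premodel_iterated_update[OF assms(1-3)] assms(4)
    by (auto simp: epistemic_premodel_def)
  show ?thesis
  proof (rule equivI)
    show "sim (run_model G M U) i \<subseteq> runs G M U \<times> runs G M U"
      by (auto simp: run_model_def)
    show "refl_on (runs G M U) (sim (run_model G M U) i)"
      using eq by (auto simp: run_model_def refl_on_def equiv_def in_runs_iff[OF assms(1)])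
    show "sym (sim (run_model G M U) i)"
      using equivE[OF eq] by (auto simp: run_model_def intro!: symI) (metis symD)
    show "trans (sim (run_model G M U) i)"
      using equivE[OF eq] by (auto simp: run_model_def intro!: transI) (metis transD)
  qed
qed

lemma epistemic_temporal_model_run_model:
  assumes "game_structure I Act P pa G" and "observation_model I Act U"
    and "epistemic_model I G M"
  shows "epistemic_temporal_model I Act P (run_model G M U)"
proof -
  \<comment> \<open>Runs without actions keep the run model non-empty even if all later products are
    empty.\<close>
  have "(w, []) \<in> runs G M U" if "w \<in> worlds M" for w
    using that by (simp add: runs_def)
  then have "runs G M U \<noteq> {}"
    using assms(3) by (auto simp: epistemic_model_def)
  moreover have "val (run_model G M U) w i \<subseteq> P" if "w \<in> runs G M U" "i \<in> I" for w i
    using that run_state_in_gstates[OF assms] assms(1)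
    by (simp add: val_run_model[OF assms] game_structure_def)
  moreover have "points (run_model G M U) = runs G M U"
    "trns (run_model G M U) a \<subseteq> runs G M U \<times> runs G M U" for a
    by (auto simp: run_model_def)
  ultimately show ?thesis
    using equiv_sim_run_model[OF assms] by (simp add: epistemic_temporal_model_def)
qed

text \<open>Indistinguishability is the kernel of \<open>obs G\<close> on states, and the domain and
  range clauses of \<open>game_structure\<close> keep both ends of a move among the states.\<close>

lemma epistemic_temporal_model_induced_epistemic_game:
  assumes "game_structure I Act P pa G"
  shows "epistemic_temporal_model I Act P (induced_epistemic_game G)"
  using assms
  by (auto simp: epistemic_temporal_model_def induced_epistemic_game_def game_structure_def
      ran_def intro!: equivI refl_onI symI transI; blast)

section \<open>The p-morphism conditions for the state assignment\<close>

theorem proposition12: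
  fixes I :: "'i set" and Act :: "'i \<Rightarrow> 'a set" and P :: "'p set" and pa :: "'a \<Rightarrow> 'p"
    and G :: "('s, 'i, 'a, 'p) game" and M :: "('w, 's, 'i, 'p) epmodel" and U :: "'i \<Rightarrow> 'a rel"
  assumes "fixed_data I Act P pa"
    and "game_structure I Act P pa G"
    and "perfect_information I G"
    and "epistemic_model I G M"
    and "observation_model I Act U"
  shows "p_morphism I Act P (run_model G M U) (induced_epistemic_game G) (run_state G M U)"
proof -
  note M = assms(2,5,4)
  let ?f = "run_state G M U"
  have id: "s = t" if "(s, t) \<in> sim (induced_epistemic_game G) i" "i \<in> I" for s t i
    using that assms(3) by (auto simp: perfect_information_def)
  have backward_sim: "\<exists>v\<in>runs G M U. ?f v = s \<and> (w, v) \<in> sim (run_model G M U) i"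
    if "(?f w, s) \<in> sim (induced_epistemic_game G) i" "w \<in> runs G M U" "i \<in> I" for w s i
    using that id[OF that(1,3)] equiv_sim_run_model[OF M that(3)]
    by (auto simp: equiv_def refl_on_def)
  have backward_trns: "\<exists>v\<in>runs G M U. ?f v = s \<and> (w, v) \<in> trns (run_model G M U) a"
    if s: "(?f w, s) \<in> trns (induced_epistemic_game G) a" and w: "w \<in> runs G M U" for w s a
  proof -
    obtain m as where [simp]: "w = (m, as)" by (cases w)
    have "move G (?f (m, as), a) = Some s"
      using s by (simp add: induced_epistemic_game_def)
    moreover from this have r: "(m, as @ [a]) \<in> runs G M U"
      using w by (auto simp: runs_snoc_iff[OF assms(2)] enabled_def)
    \<comment> \<open>The extended run ends in the value of the same move, and \<open>move G\<close>
      is single-valued.\<close>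
    ultimately have "?f (m, as @ [a]) = s"
      using run_state_snoc[OF assms(2) r] by simp
    then show ?thesis
      using r w by (intro bexI[of _ "(m, as @ [a])"]) (auto simp: run_model_def)
  qed
  have forward_sim: "(?f w, ?f u) \<in> sim (induced_epistemic_game G) i"
    if "(w, u) \<in> sim (run_model G M U) i" "w \<in> runs G M U" "u \<in> runs G M U" "i \<in> I" for w u i
    using that run_state_in_gstates[OF M] obs_eq_if_sim_run_model[OF M that(1,4)]
    by (simp add: induced_epistemic_game_def)
  have forward_trns: "(?f w, ?f u) \<in> trns (induced_epistemic_game G) a"
    if "(w, u) \<in> trns (run_model G M U) a" for w u a
    using that run_state_snoc[OF assms(2)]
    by (auto simp: induced_epistemic_game_def run_model_def)
  have val: "val (run_model G M U) w i = val (induced_epistemic_game G) (?f w) i"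
    if "w \<in> runs G M U" "i \<in> I" for w i
    using that val_run_model[OF M] by (simp add: induced_epistemic_game_def)
  have points: "points (run_model G M U) = runs G M U"
    "points (induced_epistemic_game G) = gstates G"
    by (simp_all add: run_model_def induced_epistemic_game_def)
  show ?thesis
    unfolding p_morphism_def points
    using epistemic_temporal_model_run_model[OF M]
      epistemic_temporal_model_induced_epistemic_game[OF assms(2)] run_state_in_gstates[OF M]
    by (auto intro: backward_sim backward_trns forward_sim forward_trns simp: val)
qed

end
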